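(* Let $n\ge 1$ be an integer. There exists a constant $C(n)>0$ depending only on $n$ such that the following holds. Let $\Omega\subset\mathbb{C}$ be an open set, let $p$ be a subharmonic function in $\Omega$ satisfying the standing assumptions (1) and (2) stated in the context, and let $f\in\mathsf{A}^n_p(\Omega)$, i.e. $f$ is a polyanalytic function of order $n$ on $\Omega$ such that for every $k=0,1,\dots,n-1$ $$\int_{\Omega}|\overline{\partial}^{k}f(z)|^2e^{-p(z)}\,d\lambda(z)<+\infty.$$ If $u$ is a solution of $\overline{\partial}u=f$ on $\Omega$ satisfying the $L^2$-estimate $$\int_{\Omega}\frac{|u(z,\overline{z})|^2}{(1+|z|^2)^2}e^{-p(z)}\,d\lambda(z)\le\frac12\int_{\Omega}|f(z)|^2e^{-p(z)}\,d\lambda(z),$$ then there exists a holomorphic function $u_0\in H(\Omega)$ such that $$u(z,\overline{z})=u_0(z)-\sum_{k=1}^n\frac{(-1)^k}{k!}\,\overline{z}^k\,\overline{\partial}^{k-1}f(z),\qquad\forall z\in\Omega,$$ and moreover $$\int_{\Omega}\frac{|u_0(z)|^2}{(1+|z|^2)^{2n}}e^{-p(z)}\,d\lambda(z)\le C(n)\left(\sum_{k=0}^{n-1}\int_{\Omega}|\overline{\partial}^{k}f(z)|^2e^{-p(z)}\,d\lambda(z)\right)<+\infty.$$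
   Context: Notation: $\overline{\partial}=\frac{\partial}{\partial\overline z}=\frac12\left(\frac{\partial}{\partial x}+i\frac{\partial}{\partial y}\right)$ for $z=x+iy$, and $\overline{\partial}^k$ is its $k$-th power ($\overline{\partial}^0$ is the identity); solutions of $\overline{\partial}u=f$ are classical (real-differentiable functions on $\Omega$ satisfying the equation at every point); $d\lambda$ is Lebesgue measure on $\mathbb{C}$; $H(\Omega)$ is the space of holomorphic functions on $\Omega$. Standing assumptions on $p$: (1) $p(z)\ge 0$ and $\log(1+|z|^2)=O(p(z))$, i.e. there is $M>0$ with $\log(1+|z|^2)\le M p(z)$ for all $z$; (2) there exist constants $C,D>0$ such that $|z-w|\le 1$ implies $p(z)\le Cp(w)+D$. A function of class $\mathcal{C}^n$ on $\Omega$ is polyanalytic of order $n$ if $\overline{\partial}^n f=0$ on $\Omega$. *)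

theory Defs
  imports "HOL-Analysis.Analysis"
begin

text \<open>Functions on an open set \<open>\<Omega>\<close> of the complex plane are total functions whose values outside
  \<open>\<Omega>\<close> are never used. The complex plane is identified with the real plane: \<open>differentiable\<close>
  (as opposed to \<open>field_differentiable\<close>) means real (Frechet) differentiable.\<close>

definition dx :: "(complex \<Rightarrow> complex) \<Rightarrow> complex \<Rightarrow> complex" where
  "dx f z = frechet_derivative f (at z) 1"

definition dy :: "(complex \<Rightarrow> complex) \<Rightarrow> complex \<Rightarrow> complex" where
  "dy f z = frechet_derivative f (at z) \<i>"

definition dbar :: "(complex \<Rightarrow> complex) \<Rightarrow> complex \<Rightarrow> complex" where
  "dbar f z = (1/2) * (dx f z + \<i> * dy f z)"

primrec Ck_on :: "nat \<Rightarrow> (complex \<Rightarrow> complex) \<Rightarrow> complex set \<Rightarrow> bool" where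
  "Ck_on 0 f \<Omega> \<longleftrightarrow> continuous_on \<Omega> f"
| "Ck_on (Suc k) f \<Omega> \<longleftrightarrow>
     (\<forall>z\<in>\<Omega>. f differentiable at z) \<and> Ck_on k (dx f) \<Omega> \<and> Ck_on k (dy f) \<Omega>"

definition polyanalytic_on :: "nat \<Rightarrow> (complex \<Rightarrow> complex) \<Rightarrow> complex set \<Rightarrow> bool" where
  "polyanalytic_on n f \<Omega> \<longleftrightarrow> Ck_on n f \<Omega> \<and> (\<forall>z\<in>\<Omega>. (dbar ^^ n) f z = 0)"

definition upper_semicontinuous_on :: "complex set \<Rightarrow> (complex \<Rightarrow> real) \<Rightarrow> bool" where
  "upper_semicontinuous_on \<Omega> p \<longleftrightarrow> (\<forall>a\<in>\<Omega>. \<forall>c>p a. \<forall>\<^sub>F z in at a within \<Omega>. p z < c)"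

text \<open>Subharmonic functions that do not take the value minus infinity; this is no restriction for the
  nonnegative weights considered here. The integrability requirement is automatic: the function is
  bounded above on the circle, and a finite value at the centre bounds the mean from below. It is
  spelled out because a Bochner integral that does not exist has the value 0.\<close>

definition subharmonic_on :: "(complex \<Rightarrow> real) \<Rightarrow> complex set \<Rightarrow> bool" where
  "subharmonic_on p \<Omega> \<longleftrightarrow>
     upper_semicontinuous_on \<Omega> p \<and>
     (\<forall>a r. r > 0 \<and> cball a r \<subseteq> \<Omega> \<longrightarrow>
        set_integrable lborel {0..2*pi} (\<lambda>t. p (a + of_real r * cis t)) \<and>
        p a \<le> (1 / (2*pi)) * (LINT t:{0..2*pi}|lborel. p (a + of_real r * cis t)))"

definition admissible_weight_on :: "(complex \<Rightarrow> real) \<Rightarrow> complex set \<Rightarrow> bool" where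
  "admissible_weight_on p \<Omega> \<longleftrightarrow>
     (\<forall>z\<in>\<Omega>. p z \<ge> 0) \<and>
     (\<exists>M>0. \<forall>z\<in>\<Omega>. ln (1 + (cmod z)\<^sup>2) \<le> M * p z) \<and>
     (\<exists>C>0. \<exists>D>0. \<forall>z\<in>\<Omega>. \<forall>w\<in>\<Omega>. cmod (z - w) \<le> 1 \<longrightarrow> p z \<le> C * p w + D)"

definition weighted_norm_sq :: "complex set \<Rightarrow> (complex \<Rightarrow> real) \<Rightarrow> (complex \<Rightarrow> complex) \<Rightarrow> ennreal" where
  "weighted_norm_sq \<Omega> p g = (\<integral>\<^sup>+z\<in>\<Omega>. ennreal ((cmod (g z))\<^sup>2 * exp (- p z)) \<partial>lborel)"

definition A_space :: "nat \<Rightarrow> (complex \<Rightarrow> real) \<Rightarrow> complex set \<Rightarrow> (complex \<Rightarrow> complex) set" where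
  "A_space n p \<Omega> =
     {f. polyanalytic_on n f \<Omega> \<and> (\<forall>k<n. weighted_norm_sq \<Omega> p ((dbar ^^ k) f) < \<infinity>)}"

definition dbar_solution_on :: "(complex \<Rightarrow> complex) \<Rightarrow> (complex \<Rightarrow> complex) \<Rightarrow> complex set \<Rightarrow> bool" where
  "dbar_solution_on u f \<Omega> \<longleftrightarrow> (\<forall>z\<in>\<Omega>. u differentiable at z \<and> dbar u z = f z)"

end

(* Weighting the derivatives of f by cnj z ^ k / k! with alternating signs makes the dbar-derivative
   of the sum telescope to -f, so u0 = u + sum is annihilated by dbar, i.e. satisfies the
   Cauchy-Riemann equations. The estimate follows from Cauchy-Schwarz and
   |z| ^ (2 k) <= (1 + |z|^2) ^ (2 n) for k <= n; upper semicontinuity of the weight serves only to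
   make the integrands measurable. *)
theory Submission
  imports Defs
begin

section \<open>The operator dbar\<close>

text \<open>By uniqueness of the Frechet derivative, any derivative at hand may replace the one
  picked by the choice operator behind \<open>dx\<close> and \<open>dy\<close>.\<close>

lemma dbar_eqI:
  assumes "(f has_derivative f') (at z)"
  shows "dbar f z = (1/2) * (f' 1 + \<i> * f' \<i>)"
  using frechet_derivative_at[OF assms] by (simp add: dbar_def dx_def dy_def)

lemma dbar_add:
  assumes "f differentiable at z" "g differentiable at z"
  shows "dbar (\<lambda>w. f w + g w) z = dbar f z + dbar g z"
  using dbar_eqI[OF has_derivative_add[OF assms[unfolded frechet_derivative_works]]]
  by (simp add: dbar_def dx_def dy_def algebra_simps)

lemma dbar_sum:
  assumes "\<And>i. i \<in> I \<Longrightarrow> f i differentiable at z"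
  shows "dbar (\<lambda>w. \<Sum>i\<in>I. f i w) z = (\<Sum>i\<in>I. dbar (f i) z)"
proof -
  have "((\<lambda>w. \<Sum>i\<in>I. f i w) has_derivative (\<lambda>h. \<Sum>i\<in>I. frechet_derivative (f i) (at z) h)) (at z)"
    using assms by (intro has_derivative_sum) (simp add: frechet_derivative_works)
  from dbar_eqI[OF this] have "dbar (\<lambda>w. \<Sum>i\<in>I. f i w) z
      = (1/2) * ((\<Sum>i\<in>I. dx (f i) z) + \<i> * (\<Sum>i\<in>I. dy (f i) z))"
    by (simp add: dx_def dy_def)
  then show ?thesis
    unfolding dbar_def[of "f _"] by (simp only: sum.distrib sum_distrib_left[symmetric])
qed

lemma dbar_mult:
  assumes "f differentiable at z" "g differentiable at z"
  shows "dbar (\<lambda>w. f w * g w) z = dbar f z * g z + f z * dbar g z"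
  using dbar_eqI[OF has_derivative_mult[OF assms[unfolded frechet_derivative_works]]]
  by (simp add: dbar_def dx_def dy_def algebra_simps)

lemma has_derivative_cnj_power:
  "((\<lambda>w. c * cnj w ^ k) has_derivative (\<lambda>h. c * (of_nat k * cnj h * cnj z ^ (k - 1)))) (at z)"
  by (intro has_derivative_mult_right has_derivative_power bounded_linear_imp_has_derivative
      bounded_linear_cnj)

text \<open>Conjugation is real linear, hence its own derivative, and (1 + i * cnj i) / 2 = 1. At k
  = 0 the truncated exponent \<open>k - 1\<close> is harmless because the factor
  \<open>of_nat k\<close> vanishes.\<close>

lemma dbar_cnj_power: "dbar (\<lambda>w. c * cnj w ^ k) z = c * of_nat k * cnj z ^ (k - 1)"
  by (subst dbar_eqI[OF has_derivative_cnj_power]) (simp add: algebra_simps)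

text \<open>The equation says f' i = i * f' 1. Expanding h over the real basis 1, i then shows that
  the real linear map f' is multiplication by f' 1.\<close>

lemma dbar_zero_imp_field_differentiable:
  assumes "f differentiable at z" "dbar f z = 0"
  shows "f field_differentiable at z"
proof -
  obtain f' where f': "(f has_derivative f') (at z)"
    using assms(1) by (auto simp: differentiable_def)
  then interpret linear f' by (rule has_derivative_linear)
  have "f' 1 + \<i> * f' \<i> = 0"
    using assms(2) dbar_eqI[OF f'] by simp
  then have "\<i> * (f' 1 + \<i> * f' \<i>) = 0" by simp
  then have i: "f' \<i> = \<i> * f' 1" by (simp add: algebra_simps)
  have "f' h = f' 1 * h" for h
  proof -
    have "h = Re h *\<^sub>R 1 + Im h *\<^sub>R \<i>"
      by (simp add: complex_eq_iff)
    then have "f' h = f' (Re h *\<^sub>R 1 + Im h *\<^sub>R \<i>)"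
      by (rule arg_cong)
    also have "\<dots> = of_real (Re h) * f' 1 + of_real (Im h) * (\<i> * f' 1)"
      unfolding add scale by (simp add: i scaleR_conv_of_real)
    also have "\<dots> = f' 1 * (of_real (Re h) + \<i> * of_real (Im h))"
      by (simp add: algebra_simps)
    finally show ?thesis by (simp only: complex_eq[of h, symmetric])
  qed
  then have "f' = (*) (f' 1)" by (rule ext)
  with f' have "(f has_field_derivative f' 1) (at z)"
    by (simp add: has_field_derivative_def)
  then show ?thesis by (auto simp: field_differentiable_def)
qed

section \<open>Continuous differentiability\<close>

text \<open>\<open>frechet_derivative\<close> is a choice among all derivatives at the point. Both
  functions have the same candidates, so the choices coincide, even where there is no
  derivative.\<close>

lemma frechet_derivative_cong_on:
  assumes "open S" "z \<in> S" "\<And>w. w \<in> S \<Longrightarrow> f w = g w"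
  shows "frechet_derivative f (at z) = frechet_derivative g (at z)"
proof -
  have "(f has_derivative D) (at z) \<longleftrightarrow> (g has_derivative D) (at z)" for D
    using has_derivative_transform_within_open[of f D z UNIV S g]
      has_derivative_transform_within_open[of g D z UNIV S f] assms by auto
  then show ?thesis by (simp add: frechet_derivative_def)
qed

lemma differentiable_cong_on:
  assumes "open S" "z \<in> S" "\<And>w. w \<in> S \<Longrightarrow> f w = g w" "f differentiable at z"
  shows "g differentiable at z"
  using has_derivative_transform_within_open[OF _ assms(1,2), of f _ UNIV g] assms(3,4)
  unfolding differentiable_def by auto

text \<open>The rules for partial derivatives hold only at points of S, so inductions on the order
  must pass between functions that agree merely on S.\<close>

lemma Ck_on_cong:
  assumes "open S" "\<And>w. w \<in> S \<Longrightarrow> f w = g w" "Ck_on k f S"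
  shows "Ck_on k g S"
  using assms
proof (induction k arbitrary: f g)
  case 0
  then show ?case using continuous_on_cong[of S S f g] by simp
next
  case (Suc k)
  note d = frechet_derivative_cong_on[OF Suc.prems(1) _ Suc.prems(2)]
  have "dx f w = dx g w" "dy f w = dy g w" if "w \<in> S" for w
    using d[OF that] by (simp_all add: dx_def dy_def)
  note eq = this
  have "Ck_on k (dx f) S" "Ck_on k (dy f) S"
    using Suc.prems(3) by simp_all
  note C = Suc.IH[OF Suc.prems(1) eq(1) this(1)] Suc.IH[OF Suc.prems(1) eq(2) this(2)]
  have "\<forall>z\<in>S. g differentiable at z"
    using Suc.prems(3) by (auto intro: differentiable_cong_on[OF Suc.prems(1) _ Suc.prems(2)])
  with C show ?case by (simp only: Ck_on.simps)
qed

text \<open>Meant for dbar = 1/2 * dx + i/2 * dy, hence the complex coefficients. Partial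
  derivatives of a combination are combinations again, which closes the induction over all f and
  g.\<close>

lemma Ck_on_linear_combination:
  assumes "open S" "Ck_on k f S" "Ck_on k g S"
  shows "Ck_on k (\<lambda>z. a * f z + b * g z) S"
  using assms
proof (induction k arbitrary: f g)
  case 0
  then show ?case by (auto intro!: continuous_intros)
next
  case (Suc k)
  have fd: "frechet_derivative (\<lambda>z. a * f z + b * g z) (at z)
      = (\<lambda>h. a * frechet_derivative f (at z) h + b * frechet_derivative g (at z) h)"
    if "z \<in> S" for z
    using Suc.prems that
    by (intro frechet_derivative_at[symmetric] has_derivative_add has_derivative_mult_right)
       (auto simp: frechet_derivative_works[symmetric])
  then have lin: "a * dx f z + b * dx g z = dx (\<lambda>z. a * f z + b * g z) z"
    "a * dy f z + b * dy g z = dy (\<lambda>z. a * f z + b * g z) z" if "z \<in> S" for z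
    using that by (simp_all add: dx_def dy_def)
  have "Ck_on k (\<lambda>z. a * dx f z + b * dx g z) S" "Ck_on k (\<lambda>z. a * dy f z + b * dy g z) S"
    using Suc.prems Suc.IH by simp_all
  note C = Ck_on_cong[OF Suc.prems(1) lin(1) this(1)] Ck_on_cong[OF Suc.prems(1) lin(2) this(2)]
  have "(\<lambda>z. a * f z + b * g z) differentiable at z" if "z \<in> S" for z
    using Suc.prems(2,3) that
    by (intro differentiable_add differentiable_mult differentiable_const) auto
  then have "\<forall>z\<in>S. (\<lambda>z. a * f z + b * g z) differentiable at z" by (rule ballI)
  with C show ?case by (simp only: Ck_on.simps)
qed

lemma Ck_on_dbar:
  assumes "open S" "Ck_on (Suc k) f S"
  shows "Ck_on k (dbar f) S"
  using Ck_on_linear_combination[OF assms(1), of k "dx f" "dy f" "1/2" "1/2 * \<i>"] assms(2)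
  by (simp add: dbar_def[abs_def] algebra_simps)

text \<open>Each application of dbar costs one order of smoothness; the form \<open>k + j\<close>
  lets the induction on j use its hypothesis at \<open>Suc k\<close>.\<close>

lemma Ck_on_dbar_funpow:
  assumes "open S" "Ck_on (k + j) f S"
  shows "Ck_on k ((dbar ^^ j) f) S"
  using assms(2) by (induction j arbitrary: k) (simp_all add: Ck_on_dbar assms(1) del: Ck_on.simps)

lemma Ck_on_imp_differentiable_dbar_funpow:
  assumes "open S" "Ck_on n f S" "j < n" "z \<in> S"
  shows "(dbar ^^ j) f differentiable at z"
proof -
  \<comment> \<open>Since j < n, at least one order of smoothness is left after j
    applications.\<close>
  have "Suc (n - Suc j) + j = n" using assms(3) by simp
  then have "Ck_on (Suc (n - Suc j)) ((dbar ^^ j) f) S"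
    using assms(1,2) by (intro Ck_on_dbar_funpow) simp_all
  with assms(4) show ?thesis by simp
qed

section \<open>The corrected solution\<close>

lemma polyanalytic_dbar_correction:
  assumes "open S" "polyanalytic_on n f S" "z \<in> S"
  defines "T \<equiv> \<lambda>z. \<Sum>k=1..n. (-1)^k / fact k * (cnj z)^k * (dbar ^^ (k - 1)) f z"
  shows "T differentiable at z" "dbar T z = - f z"
proof -
  \<comment> \<open>Shifting the index by one makes the derivative index k itself and ties it to the
    power \<open>Suc k\<close> of \<open>cnj z\<close>.\<close>
  define t where "t k w = (-1)^Suc k / fact (Suc k) * cnj w ^ Suc k * (dbar ^^ k) f w" for k w
  have T: "T = (\<lambda>w. \<Sum>k<n. t k w)"
    unfolding T_def t_def One_nat_def sum.atLeast1_atMost_eq by simp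
  have D: "(dbar ^^ k) f differentiable at z" if "k < n" for k
    using assms that by (auto simp: polyanalytic_on_def intro: Ck_on_imp_differentiable_dbar_funpow)
  have P: "(\<lambda>w. c * cnj w ^ k) differentiable at z" for c k
    using has_derivative_cnj_power by (rule differentiableI)
  have td: "t k differentiable at z" if "k < n" for k
    unfolding t_def by (rule differentiable_mult[OF P D[OF that]])
  then show "T differentiable at z"
    unfolding T by (intro differentiable_sum) auto
  \<comment> \<open>The product rule turns each term into a difference of neighbours of this
    sequence. Its ends are a 0 = f z and a n, which vanishes because it contains the n-th power of
    dbar applied to f.\<close>
  define a where "a k = (-1)^k / fact k * cnj z ^ k * (dbar ^^ k) f z" for k
  have t: "dbar (t k) z = a (Suc k) - a k" if "k < n" for k
  proof -
    have "dbar (t k) z = (-1)^Suc k / fact (Suc k) * of_nat (Suc k) * cnj z ^ k * (dbar ^^ k) f z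
        + a (Suc k)"
      unfolding t_def dbar_mult[OF P D[OF that]] dbar_cnj_power a_def by simp
    also have "(-1)^Suc k / fact (Suc k) * of_nat (Suc k) = - ((-1)^k / fact k :: complex)"
      by (simp add: field_simps del: of_nat_Suc)
    finally show ?thesis by (simp add: a_def)
  qed
  have "dbar T z = (\<Sum>k<n. a (Suc k) - a k)"
    unfolding T using td t by (subst dbar_sum) auto
  also have "\<dots> = a n - a 0" by (rule sum_lessThan_telescope)
  also have "\<dots> = - f z"
    using assms(2,3) by (simp add: a_def polyanalytic_on_def)
  finally show "dbar T z = - f z" .
qed

section \<open>The weighted estimate\<close>

text \<open>Upper semicontinuity on an open set makes the strict sublevel sets open. The restricted
  sigma-algebra appears because p is uncontrolled outside S.\<close>

lemma upper_semicontinuous_on_borel_measurable: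
  fixes p :: "complex \<Rightarrow> real"
  assumes "open S" "upper_semicontinuous_on S p"
  shows "p \<in> borel_measurable (restrict_space borel S)"
proof (subst borel_measurable_iff_less, intro allI)
  fix c
  have "open {w \<in> S. p w < c}"
  proof (subst open_subopen, safe)
    fix a assume a: "a \<in> S" "p a < c"
    then have "\<forall>\<^sub>F z in at a. p z < c"
      using assms at_within_open[of a S] by (auto simp: upper_semicontinuous_on_def)
    \<comment> \<open>The filter \<open>at a\<close> ignores a itself; there the inequality is the
      assumption p a < c.\<close>
    then obtain T where "open T" "a \<in> T" "\<forall>z\<in>T. z \<noteq> a \<longrightarrow> p z < c"
      by (auto simp: eventually_at_topological)
    then show "\<exists>T. open T \<and> a \<in> T \<and> T \<subseteq> {w \<in> S. p w < c}"
      using a assms(1) by (intro exI[of _ "S \<inter> T"]) auto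
  qed
  then show "{w \<in> space (restrict_space borel S). p w < c} \<in> sets (restrict_space borel S)"
    using assms(1) by (auto simp: sets_restrict_space_iff space_restrict_space)
qed

lemma corrected_solution_bound:
  fixes u z :: complex and F :: "nat \<Rightarrow> complex"
  assumes "n \<ge> 1"
  shows "(cmod (u + (\<Sum>k=1..n. (-1)^k / fact k * (cnj z)^k * F (k - 1))))\<^sup>2 / (1 + (cmod z)\<^sup>2)^(2*n)
    \<le> 2 * ((cmod u)\<^sup>2 / (1 + (cmod z)\<^sup>2)^2) + 2 * real n * (\<Sum>k<n. (cmod (F k))\<^sup>2)"
proof -
  define A where "A = 1 + (cmod z)\<^sup>2"
  have A: "A \<ge> 1" by (simp add: A_def)
  define s where "s k = (-1)^Suc k / fact (Suc k) * (cnj z)^Suc k * F k" for k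
  have s: "(cmod (s k))\<^sup>2 \<le> A^(2*n) * (cmod (F k))\<^sup>2" if "k < n" for k
  proof -
    have "(cmod (s k))\<^sup>2 = ((cmod z)\<^sup>2) ^ Suc k * (cmod (F k))\<^sup>2 / (fact (Suc k))\<^sup>2"
      by (simp add: s_def norm_mult norm_divide norm_power power_mult_distrib power_divide
          power_mult[symmetric] mult.commute[of 2] del: fact_Suc power_Suc)
    also have "\<dots> \<le> ((cmod z)\<^sup>2) ^ Suc k * (cmod (F k))\<^sup>2"
      using divide_left_mono[of 1 "(fact (Suc k))\<^sup>2 :: real" "((cmod z)\<^sup>2) ^ Suc k * (cmod (F k))\<^sup>2"]
      by (simp add: one_le_power del: fact_Suc power_Suc)
    also have "\<dots> \<le> A ^ Suc k * (cmod (F k))\<^sup>2"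
      by (intro mult_right_mono power_mono) (auto simp: A_def)
    \<comment> \<open>Here Suc k <= n <= 2 * n and A >= 1, so one power of A serves for all terms
      and later cancels the denominator.\<close>
    also have "\<dots> \<le> A ^ (2*n) * (cmod (F k))\<^sup>2"
      using that A by (intro mult_right_mono power_increasing) auto
    finally show ?thesis .
  qed
  have "(cmod (u + (\<Sum>k<n. s k)))\<^sup>2 \<le> (cmod u + cmod (\<Sum>k<n. s k))\<^sup>2"
    by (intro power_mono norm_triangle_ineq) auto
  also have "\<dots> \<le> 2 * (cmod u)\<^sup>2 + 2 * (cmod (\<Sum>k<n. s k))\<^sup>2"
    using sum_squares_bound[of "cmod u" "cmod (\<Sum>k<n. s k)"] by (simp add: power2_sum)
  also have "(cmod (\<Sum>k<n. s k))\<^sup>2 \<le> (\<Sum>k<n. cmod (s k))\<^sup>2"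
    by (intro power_mono norm_sum) auto
  \<comment> \<open>Cauchy-Schwarz against the constant vector of length n produces the factor
    n.\<close>
  also have "\<dots> \<le> real n * (\<Sum>k<n. (cmod (s k))\<^sup>2)"
    using sum_squared_le_sum_of_squares[of "\<lambda>k. cmod (s k)" "{..<n}"] by (simp add: mult.commute)
  also have "(\<Sum>k<n. (cmod (s k))\<^sup>2) \<le> A^(2*n) * (\<Sum>k<n. (cmod (F k))\<^sup>2)"
    unfolding sum_distrib_left using s by (intro sum_mono) auto
  finally have "(cmod (u + (\<Sum>k<n. s k)))\<^sup>2 / A^(2*n)
      \<le> (2 * (cmod u)\<^sup>2 + 2 * (real n * (A^(2*n) * (\<Sum>k<n. (cmod (F k))\<^sup>2)))) / A^(2*n)"
    using A by (intro divide_right_mono) (auto simp: mult_left_mono)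
  also have "\<dots> = 2 * ((cmod u)\<^sup>2 / A^(2*n)) + 2 * real n * (\<Sum>k<n. (cmod (F k))\<^sup>2)"
    using A by (simp add: field_simps)
  \<comment> \<open>As n >= 1 gives 2 <= 2 * n, the denominator can be lowered to the one in the
    hypothesis on u.\<close>
  also have "(cmod u)\<^sup>2 / A^(2*n) \<le> (cmod u)\<^sup>2 / A^2"
    using A assms by (intro divide_left_mono power_increasing) auto
  finally show ?thesis
    unfolding A_def s_def One_nat_def sum.atLeast1_atMost_eq by simp
qed

text \<open>Integrates the pointwise bound. The u-term, with its factor 2, contributes at most one
  copy of the sum of norms and the F-terms contribute 2 * n copies, whence 2 * n + 1.\<close>

lemma corrected_solution_estimate:
  fixes p :: "complex \<Rightarrow> real" and u :: "complex \<Rightarrow> complex" and F :: "nat \<Rightarrow> complex \<Rightarrow> complex"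
  assumes "n \<ge> 1" "open S" "upper_semicontinuous_on S p" "continuous_on S u"
    and F: "\<And>k. k < n \<Longrightarrow> continuous_on S (F k)"
    and u: "(\<integral>\<^sup>+z\<in>S. ennreal ((cmod (u z))\<^sup>2 / (1 + (cmod z)\<^sup>2)^2 * exp (- p z)) \<partial>lborel)
         \<le> ennreal (1/2) * weighted_norm_sq S p (F 0)"
  shows "(\<integral>\<^sup>+z\<in>S. ennreal
      ((cmod (u z + (\<Sum>k=1..n. (-1)^k / fact k * (cnj z)^k * F (k - 1) z)))\<^sup>2
        / (1 + (cmod z)\<^sup>2)^(2*n) * exp (- p z)) \<partial>lborel)
    \<le> ennreal (2 * real n + 1) * (\<Sum>k<n. weighted_norm_sq S p (F k))"
proof -
  \<comment> \<open>The functions are arbitrary outside S, so measurability is available only on the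
    restricted measure space.\<close>
  define N where "N = restrict_space (lborel :: complex measure) S"
  have set_int: "(\<integral>\<^sup>+z\<in>S. g z \<partial>lborel) = (\<integral>\<^sup>+z. g z \<partial>N)" for g
    using assms(2) unfolding N_def by (subst nn_integral_restrict_space) auto
  have meas: "borel_measurable N = borel_measurable (restrict_space borel S)"
    unfolding N_def by (intro measurable_cong_sets sets_restrict_space_cong) auto
  have [measurable]: "p \<in> borel_measurable N"
    unfolding meas using assms(2,3) by (rule upper_semicontinuous_on_borel_measurable)
  have [measurable]: "u \<in> borel_measurable N"
    unfolding meas using assms(4) by (rule borel_measurable_continuous_on_restrict)
  have [measurable]: "F k \<in> borel_measurable N" if "k < n" for k
    unfolding meas using F[OF that] by (rule borel_measurable_continuous_on_restrict)
  have [measurable]: "(\<lambda>z. z) \<in> borel_measurable N"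
    unfolding meas by (intro borel_measurable_continuous_on_restrict continuous_intros)
  define U where "U z = ennreal ((cmod (u z))\<^sup>2 / (1 + (cmod z)\<^sup>2)^2 * exp (- p z))" for z
  define G where "G k z = ennreal ((cmod (F k z))\<^sup>2 * exp (- p z))" for k z
  have [measurable]: "U \<in> borel_measurable N"
    unfolding U_def[abs_def] by measurable
  have G_meas [measurable]: "G k \<in> borel_measurable N" if "k < n" for k
    using that unfolding G_def[abs_def] by measurable
  have G: "weighted_norm_sq S p (F k) = (\<integral>\<^sup>+z. G k z \<partial>N)" for k
    by (simp add: weighted_norm_sq_def set_int G_def)
  let ?W = "\<Sum>k<n. weighted_norm_sq S p (F k)"
  have "(\<integral>\<^sup>+z. ennreal
      ((cmod (u z + (\<Sum>k=1..n. (-1)^k / fact k * (cnj z)^k * F (k - 1) z)))\<^sup>2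
        / (1 + (cmod z)\<^sup>2)^(2*n) * exp (- p z)) \<partial>N)
    \<le> (\<integral>\<^sup>+z. ennreal 2 * U z + ennreal (2 * real n) * (\<Sum>k<n. G k z) \<partial>N)"
  proof (rule nn_integral_mono)
    fix z
    let ?L = "(cmod (u z + (\<Sum>k=1..n. (-1)^k / fact k * (cnj z)^k * F (k - 1) z)))\<^sup>2
        / (1 + (cmod z)\<^sup>2)^(2*n)"
    have "?L * exp (- p z) \<le> (2 * ((cmod (u z))\<^sup>2 / (1 + (cmod z)\<^sup>2)^2)
        + 2 * real n * (\<Sum>k<n. (cmod (F k z))\<^sup>2)) * exp (- p z)"
      using corrected_solution_bound[OF assms(1)] by (intro mult_right_mono) auto
    also have "\<dots> = 2 * ((cmod (u z))\<^sup>2 / (1 + (cmod z)\<^sup>2)^2 * exp (- p z))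
        + 2 * real n * (\<Sum>k<n. (cmod (F k z))\<^sup>2 * exp (- p z))"
      by (simp add: sum_distrib_right distrib_right mult.assoc)
    finally have "ennreal (?L * exp (- p z)) \<le> ennreal \<dots>"
      by (rule ennreal_leI)
    \<comment> \<open>\<open>ennreal\<close> commutes with sums and products of nonnegative reals,
      hence the list of nonnegativity facts.\<close>
    also have "\<dots> = ennreal 2 * U z + ennreal (2 * real n) * (\<Sum>k<n. G k z)"
      unfolding U_def G_def
      by (subst sum_ennreal, simp)
         (simp only: ennreal_mult[symmetric] ennreal_plus[symmetric] sum_nonneg mult_nonneg_nonneg
           divide_nonneg_nonneg zero_le_power2 zero_le_power add_nonneg_nonneg exp_ge_zero
           of_nat_0_le_iff zero_le_numeral zero_le_one)
    finally show "ennreal (?L * exp (- p z)) \<le> ennreal 2 * U z + ennreal (2 * real n) * (\<Sum>k<n. G k z)" .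
  qed
  \<comment> \<open>Additivity of the integral is where the measurability of U and G is
    used.\<close>
  also have "\<dots> = ennreal 2 * (\<integral>\<^sup>+z. U z \<partial>N) + ennreal (2 * real n) * ?W"
  proof -
    have "(\<integral>\<^sup>+z. (\<Sum>k<n. G k z) \<partial>N) = ?W"
      unfolding G using G_meas by (intro nn_integral_sum) simp
    then show ?thesis by (simp add: nn_integral_add nn_integral_cmult)
  qed
  also have "(\<integral>\<^sup>+z. U z \<partial>N) \<le> ennreal (1/2) * weighted_norm_sq S p (F 0)"
    using u by (simp add: set_int U_def)
  \<comment> \<open>The 1/2 of the assumed estimate absorbs the 2 from squaring a sum of two
    terms.\<close>
  also have "ennreal 2 * (ennreal (1/2) * weighted_norm_sq S p (F 0)) = weighted_norm_sq S p (F 0)"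
    by (simp only: mult.assoc[symmetric] ennreal_mult[symmetric]) simp
  also have "weighted_norm_sq S p (F 0) \<le> ?W"
    using assms(1) by (intro member_le_sum) auto
  also have "?W + ennreal (2 * real n) * ?W = ennreal (2 * real n + 1) * ?W"
    by (simp add: distrib_right add.commute)
  finally show ?thesis
    unfolding set_int by (simp add: mult_left_mono add_mono)
qed

theorem theorem4p9:
  fixes n :: nat
  assumes "n \<ge> 1"
  shows "\<exists>C::real. C > 0 \<and>
    (\<forall>(\<Omega>::complex set) (p::complex \<Rightarrow> real) (f::complex \<Rightarrow> complex) (u::complex \<Rightarrow> complex).
       open \<Omega> \<longrightarrow> subharmonic_on p \<Omega> \<longrightarrow> admissible_weight_on p \<Omega> \<longrightarrow>
       f \<in> A_space n p \<Omega> \<longrightarrow>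
       dbar_solution_on u f \<Omega> \<longrightarrow>
       (\<integral>\<^sup>+z\<in>\<Omega>. ennreal ((cmod (u z))\<^sup>2 / (1 + (cmod z)\<^sup>2)^2 * exp (- p z)) \<partial>lborel)
         \<le> ennreal (1/2) * weighted_norm_sq \<Omega> p f \<longrightarrow>
       (\<exists>u0. u0 holomorphic_on \<Omega> \<and>
          (\<forall>z\<in>\<Omega>. u z = u0 z - (\<Sum>k=1..n. (-1)^k / fact k * (cnj z)^k * (dbar ^^ (k - 1)) f z)) \<and>
          (\<integral>\<^sup>+z\<in>\<Omega>. ennreal ((cmod (u0 z))\<^sup>2 / (1 + (cmod z)\<^sup>2)^(2*n) * exp (- p z)) \<partial>lborel)
            \<le> ennreal C * (\<Sum>k=0..n-1. weighted_norm_sq \<Omega> p ((dbar ^^ k) f)) \<and>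
          ennreal C * (\<Sum>k=0..n-1. weighted_norm_sq \<Omega> p ((dbar ^^ k) f)) < \<infinity>))"
proof (intro exI[of _ "2 * real n + 1"] conjI allI impI)
  show "2 * real n + 1 > 0" by simp
next
  fix \<Omega> :: "complex set" and p :: "complex \<Rightarrow> real" and f u :: "complex \<Rightarrow> complex"
  assume op: "open \<Omega>" and sh: "subharmonic_on p \<Omega>" and fA: "f \<in> A_space n p \<Omega>"
    and sol: "dbar_solution_on u f \<Omega>"
    and est: "(\<integral>\<^sup>+z\<in>\<Omega>. ennreal ((cmod (u z))\<^sup>2 / (1 + (cmod z)\<^sup>2)^2 * exp (- p z)) \<partial>lborel)
         \<le> ennreal (1/2) * weighted_norm_sq \<Omega> p f"
  have poly: "polyanalytic_on n f \<Omega>" and fin: "\<And>k. k < n \<Longrightarrow> weighted_norm_sq \<Omega> p ((dbar ^^ k) f) < \<infinity>"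
    using fA by (auto simp: A_space_def)
  have ud: "u differentiable at z" "dbar u z = f z" if "z \<in> \<Omega>" for z
    using sol that by (auto simp: dbar_solution_on_def)
  define T where "T = (\<lambda>z. \<Sum>k=1..n. (-1)^k / fact k * (cnj z)^k * (dbar ^^ (k - 1)) f z)"
  note T = polyanalytic_dbar_correction[OF op poly, folded T_def]
  have cont: "continuous_on \<Omega> g" if "\<And>z. z \<in> \<Omega> \<Longrightarrow> g differentiable at z" for g :: "complex \<Rightarrow> complex"
    using that by (intro continuous_at_imp_continuous_on) (auto intro: differentiable_imp_continuous_within)
  \<comment> \<open>Subtraction is truncated: this equality relies on n >= 1.\<close>
  have idx: "{0..n - 1} = {..<n}" using assms by auto
  let ?W = "\<Sum>k=0..n-1. weighted_norm_sq \<Omega> p ((dbar ^^ k) f)"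
  let ?u0 = "\<lambda>z. u z + T z"
  have hol: "?u0 holomorphic_on \<Omega>"
    unfolding holomorphic_on_def
  proof
    fix z assume z: "z \<in> \<Omega>"
    \<comment> \<open>The two dbar-derivatives, f z for u and - f z for T, cancel.\<close>
    have "?u0 field_differentiable at z"
      using ud[OF z] T[OF z] by (intro dbar_zero_imp_field_differentiable) (auto simp: dbar_add)
    then show "?u0 field_differentiable at z within \<Omega>"
      by (rule field_differentiable_at_within)
  qed
  have bound: "(\<integral>\<^sup>+z\<in>\<Omega>. ennreal ((cmod (?u0 z))\<^sup>2 / (1 + (cmod z)\<^sup>2)^(2*n) * exp (- p z)) \<partial>lborel)
      \<le> ennreal (2 * real n + 1) * ?W"
    unfolding T_def idx
  proof (rule corrected_solution_estimate)
    show "continuous_on \<Omega> u" using ud(1) by (rule cont)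
    show "continuous_on \<Omega> ((dbar ^^ k) f)" if "k < n" for k
      using op poly that
      by (intro cont Ck_on_imp_differentiable_dbar_funpow) (auto simp: polyanalytic_on_def)
  qed (use assms op sh est in \<open>auto simp: subharmonic_on_def\<close>)
  have "ennreal (2 * real n + 1) * ?W < \<infinity>"
    unfolding idx using fin by (simp add: ennreal_mult_less_top)
  with hol bound show "\<exists>u0. u0 holomorphic_on \<Omega> \<and>
          (\<forall>z\<in>\<Omega>. u z = u0 z - (\<Sum>k=1..n. (-1)^k / fact k * (cnj z)^k * (dbar ^^ (k - 1)) f z)) \<and>
          (\<integral>\<^sup>+z\<in>\<Omega>. ennreal ((cmod (u0 z))\<^sup>2 / (1 + (cmod z)\<^sup>2)^(2*n) * exp (- p z)) \<partial>lborel)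
            \<le> ennreal (2 * real n + 1) * ?W \<and>
          ennreal (2 * real n + 1) * ?W < \<infinity>"
    by (intro exI[of _ ?u0]) (simp add: T_def)
qed

end
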